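(* Let $\phi,\xi : I\subset\mathbb{R}\to Q$ be regular quaternionic curves with parameters $s^*$ and $s$, respectively. If $(\phi,\xi)$ are quaternionic involute-evolute curves, then the spatial quaternionic curves $(\beta,\alpha)$ in $\mathbb{R}^3$ associated with $\phi$ and $\xi$, respectively, are not spatial quaternionic involute-evolute curves.
   Context: $Q$ is the algebra of real quaternions, identified with Euclidean space $\mathbb{R}^4$; $\times$ is the quaternion product, $\hat q$ the conjugate, and $h(p,q)=\frac12(p\times\hat q+q\times\hat p)$ the quaternion inner product (equal to the Euclidean inner product of $\mathbb{R}^4$). A quaternion $q$ is spatial if $q+\hat q=0$; spatial quaternions are identified with $\mathbb{R}^3$. The parameters $s$ and $s^*$ are arc-length parameters. The Serret-Frenet apparatus of a quaternionic curve $\xi=\xi(s)$ consists of an orthonormal frame $\{T_\xi,N_\xi,B_\xi,E_\xi\}$ with $T_\xi=\xi'$ and curvatures $\kappa_\xi=\|T_\xi'\|$, $k$, $r-\kappa_\xi$ satisfying $$T_\xi'=\kappa_\xi N_\xi,\quad N_\xi'=-\kappa_\xi T_\xi+kB_\xi,\quad B_\xi'=-kN_\xi+(r-\kappa_\xi)E_\xi,\quad E_\xi'=-(r-\kappa_\xi)B_\xi,$$ where $N_\xi=t\times T_\xi$, $B_\xi=n\times T_\xi$, $E_\xi=b\times T_\xi$, and $\{t,n,b\}$ is the Frenet frame (tangent, principal normal, binormal) of a curve $\alpha=\alpha(s)$ of spatial quaternions, with $\alpha'=t$, $t'=kn$, $n'=-kt+rb$, $b'=-rn$. This $\alpha$ is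 called the spatial quaternionic curve associated with $\xi$. In the same way $\beta=\beta(s^* )$, with Frenet frame $\{t^*,n^*,b^*\}$, is associated with $\phi$. The curves are assumed nondegenerate so that the frames involved are defined. Quaternionic curves $\phi$ and $\xi$, whose points are in a correspondence $s\leftrightarrow s^*$, are quaternionic involute-evolute curves ($\phi$ an involute of $\xi$) if $h(T_\phi(s^* ),T_\xi(s))=0$ at corresponding points and $\phi(s^* )$ lies on the tangent line of $\xi$ at $\xi(s)$; then $\phi(s^* )=\xi(s)+(c-s)T_\xi(s)$ for a constant $c$. The spatial curves $(\beta,\alpha)$ are spatial quaternionic involute-evolute curves if, at corresponding points (with $\beta(s^* )$ corresponding to $\alpha(s)$ when $\phi(s^* )$ corresponds to $\xi(s)$), the tangent $t^*$ of $\beta$ and the principal normal $n$ of $\alpha$ are linearly dependent. *)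

theory Defs
  imports "HOL-Analysis.Analysis"
begin

text \<open>
  Real quaternions on \<open>\<real>\<^sup>4\<close>. Component 1 is the scalar part, components 2, 3, 4
  are the coefficients of i, j, k. The library's \<open>*\<close> and \<open>1\<close> on \<open>real ^ 4\<close> are
  componentwise and are not the quaternion operations.
\<close>

type_synonym quat = "real ^ 4"

definition quat_mult :: "quat \<Rightarrow> quat \<Rightarrow> quat"  (infixl "\<times>\<^sub>Q" 70) where
  "p \<times>\<^sub>Q q = vector
     [p$1 * q$1 - p$2 * q$2 - p$3 * q$3 - p$4 * q$4,
      p$1 * q$2 + p$2 * q$1 + p$3 * q$4 - p$4 * q$3,
      p$1 * q$3 - p$2 * q$4 + p$3 * q$1 + p$4 * q$2,
      p$1 * q$4 + p$2 * q$3 - p$3 * q$2 + p$4 * q$1]"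

definition quat_cnj :: "quat \<Rightarrow> quat" where
  "quat_cnj q = vector [q$1, - q$2, - q$3, - q$4]"

definition quat_of_real :: "real \<Rightarrow> quat" where
  "quat_of_real a = vector [a, 0, 0, 0]"

definition quat_h :: "quat \<Rightarrow> quat \<Rightarrow> quat" where
  "quat_h p q = (1/2) *\<^sub>R (p \<times>\<^sub>Q quat_cnj q + q \<times>\<^sub>Q quat_cnj p)"

definition spatial :: "quat \<Rightarrow> bool" where
  "spatial q \<longleftrightarrow> q + quat_cnj q = 0"

lemma vector_4_nth [simp]:
  "(vector [a, b, c, d] :: 'a::zero ^ 4) $ 1 = a"
  "(vector [a, b, c, d] :: 'a::zero ^ 4) $ 2 = b"
  "(vector [a, b, c, d] :: 'a::zero ^ 4) $ 3 = c"
  "(vector [a, b, c, d] :: 'a::zero ^ 4) $ 4 = d"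
  unfolding vector_def by auto

lemma quat_h_eq_inner: "quat_h p q = quat_of_real (p \<bullet> q)"
  by (simp add: vec_eq_iff forall_4 quat_h_def quat_mult_def quat_cnj_def
      quat_of_real_def inner_vec_def sum_4 field_simps)

text \<open>
  Curves are parametrized by arc length on an interval \<open>I\<close>; derivatives are taken within
  \<open>I\<close>, hence one-sided at an end point belonging to \<open>I\<close>. Tangent, curvature and principal
  normal are used both for curves of spatial quaternions and for curves in \<open>\<real>\<^sup>4\<close>.
\<close>

definition tangent :: "real set \<Rightarrow> (real \<Rightarrow> quat) \<Rightarrow> real \<Rightarrow> quat" where
  "tangent I \<gamma> s = vector_derivative \<gamma> (at s within I)"

definition curvature :: "real set \<Rightarrow> (real \<Rightarrow> quat) \<Rightarrow> real \<Rightarrow> real" where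
  "curvature I \<gamma> s = norm (vector_derivative (tangent I \<gamma>) (at s within I))"

definition principal_normal :: "real set \<Rightarrow> (real \<Rightarrow> quat) \<Rightarrow> real \<Rightarrow> quat" where
  "principal_normal I \<gamma> s =
     (1 / curvature I \<gamma> s) *\<^sub>R vector_derivative (tangent I \<gamma>) (at s within I)"

text \<open>
  The quaternion product of orthogonal spatial quaternions is their cross product.
\<close>

definition binormal :: "real set \<Rightarrow> (real \<Rightarrow> quat) \<Rightarrow> real \<Rightarrow> quat" where
  "binormal I \<alpha> s = tangent I \<alpha> s \<times>\<^sub>Q principal_normal I \<alpha> s"

definition torsion :: "real set \<Rightarrow> (real \<Rightarrow> quat) \<Rightarrow> real \<Rightarrow> real" where
  "torsion I \<alpha> s = vector_derivative (principal_normal I \<alpha>) (at s within I) \<bullet> binormal I \<alpha> s"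

definition orthonormal :: "quat list \<Rightarrow> bool" where
  "orthonormal vs \<longleftrightarrow>
     (\<forall>i<length vs. \<forall>j<length vs. vs ! i \<bullet> vs ! j = (if i = j then 1 else 0))"

text \<open>
  A nondegenerate arc-length parametrized curve of spatial quaternions with its Frenet
  frame \<open>t, n, b\<close>, curvature \<open>k\<close> and torsion \<open>r\<close>.
\<close>

definition spatial_quaternionic_curve :: "real set \<Rightarrow> (real \<Rightarrow> quat) \<Rightarrow> bool" where
  "spatial_quaternionic_curve I \<alpha> \<longleftrightarrow>
    (let t = tangent I \<alpha>; n = principal_normal I \<alpha>; b = binormal I \<alpha>;
         k = curvature I \<alpha>; r = torsion I \<alpha>
     in \<forall>s\<in>I.
        spatial (\<alpha> s) \<and>
        k s > 0 \<and>
        orthonormal [t s, n s, b s] \<and>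
        (\<alpha> has_vector_derivative t s) (at s within I) \<and>
        (t has_vector_derivative k s *\<^sub>R n s) (at s within I) \<and>
        (n has_vector_derivative - k s *\<^sub>R t s + r s *\<^sub>R b s) (at s within I) \<and>
        (b has_vector_derivative - r s *\<^sub>R n s) (at s within I))"

text \<open>
  The curve \<open>\<xi>\<close> in \<open>\<real>\<^sup>4\<close> has a Serret-Frenet apparatus and \<open>\<alpha>\<close> is the spatial
  quaternionic curve associated with it. As \<open>T\<close> is a unit quaternion and \<open>N = t \<times>\<^sub>Q T\<close>,
  the tangent \<open>t\<close> is determined by \<open>\<xi>\<close>, so \<open>\<alpha>\<close> is determined up to translation.
\<close>

definition associated_spatial_curve ::
    "real set \<Rightarrow> (real \<Rightarrow> quat) \<Rightarrow> (real \<Rightarrow> quat) \<Rightarrow> bool" where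
  "associated_spatial_curve I \<xi> \<alpha> \<longleftrightarrow>
    spatial_quaternionic_curve I \<alpha> \<and>
    (let t = tangent I \<alpha>; n = principal_normal I \<alpha>; b = binormal I \<alpha>;
         k = curvature I \<alpha>; r = torsion I \<alpha>;
         T = tangent I \<xi>; N = principal_normal I \<xi>; \<kappa> = curvature I \<xi>;
         B = (\<lambda>s. n s \<times>\<^sub>Q T s); E = (\<lambda>s. b s \<times>\<^sub>Q T s)
     in \<forall>s\<in>I.
        \<kappa> s > 0 \<and>
        N s = t s \<times>\<^sub>Q T s \<and>
        orthonormal [T s, N s, B s, E s] \<and>
        (\<xi> has_vector_derivative T s) (at s within I) \<and>
        (T has_vector_derivative \<kappa> s *\<^sub>R N s) (at s within I) \<and>
        (N has_vector_derivative - \<kappa> s *\<^sub>R T s + k s *\<^sub>R B s) (at s within I) \<and>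
        (B has_vector_derivative - k s *\<^sub>R N s + (r s - \<kappa> s) *\<^sub>R E s) (at s within I) \<and>
        (E has_vector_derivative - (r s - \<kappa> s) *\<^sub>R B s) (at s within I))"

text \<open>
  In the next two definitions the point with parameter \<open>\<sigma> s \<in> J\<close> on the first curve
  corresponds to the point with parameter \<open>s \<in> I\<close> on the second one.
\<close>

definition quaternionic_involute_evolute ::
    "real set \<Rightarrow> real set \<Rightarrow> (real \<Rightarrow> real) \<Rightarrow> (real \<Rightarrow> quat) \<Rightarrow> (real \<Rightarrow> quat) \<Rightarrow> bool" where
  "quaternionic_involute_evolute J I \<sigma> \<phi> \<xi> \<longleftrightarrow>
    (\<forall>s\<in>I. quat_h (tangent J \<phi> (\<sigma> s)) (tangent I \<xi> s) = 0 \<and>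
           (\<exists>l::real. \<phi> (\<sigma> s) = \<xi> s + l *\<^sub>R tangent I \<xi> s))"

text \<open>
  Linear dependence of a pair, not of a set: the library's \<open>dependent {x, y}\<close> fails for
  \<open>x = y \<noteq> 0\<close>.
\<close>

definition linearly_dependent_pair :: "quat \<Rightarrow> quat \<Rightarrow> bool" where
  "linearly_dependent_pair x y \<longleftrightarrow>
     (\<exists>a b::real. (a \<noteq> 0 \<or> b \<noteq> 0) \<and> a *\<^sub>R x + b *\<^sub>R y = 0)"

definition spatial_involute_evolute ::
    "real set \<Rightarrow> real set \<Rightarrow> (real \<Rightarrow> real) \<Rightarrow> (real \<Rightarrow> quat) \<Rightarrow> (real \<Rightarrow> quat) \<Rightarrow> bool" where
  "spatial_involute_evolute J I \<sigma> \<beta> \<alpha> \<longleftrightarrow>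
    (\<forall>s\<in>I. linearly_dependent_pair (tangent J \<beta> (\<sigma> s)) (principal_normal I \<alpha> s))"

end

theory Submission
  imports Defs
begin

text \<open>
  Write \<open>\<phi> (\<sigma> s) = \<xi> s + l s *\<^sub>R T s\<close>. Orthogonality of the tangents gives \<open>l' = -1\<close> and
  \<open>\<sigma>' *\<^sub>R T\<^sub>\<phi> = (l * \<kappa>) *\<^sub>R N\<close>, so near a parameter with \<open>l \<noteq> 0\<close> the tangent \<open>T\<^sub>\<phi>\<close> is \<open>\<plusminus>N\<close>.
  Differentiating once more, \<open>N\<^sub>\<phi>\<close> lies in the plane spanned by \<open>T\<close> and \<open>B\<close>. If the tangent
  of \<open>\<beta>\<close> were a multiple of \<open>n\<close>, then \<open>N\<^sub>\<phi>\<close> would be a multiple of \<open>n \<times>\<^sub>Q N\<close>, hence of \<open>E\<close>,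
  which is orthogonal to that plane.
\<close>

section \<open>Quaternion products and the Euclidean inner product\<close>

lemma quat_mult_scaleR [simp]:
  "(a *\<^sub>R p) \<times>\<^sub>Q q = a *\<^sub>R (p \<times>\<^sub>Q q)" "p \<times>\<^sub>Q (a *\<^sub>R q) = a *\<^sub>R (p \<times>\<^sub>Q q)"
  by (simp_all add: vec_eq_iff forall_4 quat_mult_def algebra_simps)

text \<open>Multiplicativity of the quaternion norm, polarised in the right factor.\<close>

lemma inner_quat_mult_left: "(p \<times>\<^sub>Q x) \<bullet> (p \<times>\<^sub>Q y) = (p \<bullet> p) * (x \<bullet> y)"
  by (simp add: quat_mult_def inner_vec_def sum_4 algebra_simps)

text \<open>Right multiplication by \<open>x\<close> scales inner products by
  \<open>x \<bullet> x\<close>; comparing \<open>p\<close> with the quaternion unit leaves its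
  scalar part.\<close>

lemma inner_quat_mult_same: "(p \<times>\<^sub>Q x) \<bullet> x = p $ 1 * (x \<bullet> x)"
  by (simp add: quat_mult_def inner_vec_def sum_4 algebra_simps)

text \<open>By associativity, the previous identity for \<open>p \<times>\<^sub>Q q\<close>, whose
  scalar part is \<open>2 * p $ 1 * q $ 1 - p \<bullet> q\<close>.\<close>

lemma inner_quat_mult_mult_same:
  "(p \<times>\<^sub>Q (q \<times>\<^sub>Q x)) \<bullet> x = (2 * p $ 1 * q $ 1 - p \<bullet> q) * (x \<bullet> x)"
  by (simp add: quat_mult_def inner_vec_def sum_4 algebra_simps)

lemma quat_h_eq_0_iff: "quat_h p q = 0 \<longleftrightarrow> p \<bullet> q = 0"
  by (simp add: quat_h_eq_inner quat_of_real_def vec_eq_iff forall_4)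

lemma linearly_dependent_pair_scaleR:
  assumes "linearly_dependent_pair x y" "x \<noteq> 0" "y \<noteq> 0"
  obtains c where "x = c *\<^sub>R y"
proof -
  obtain a b where ab: "a \<noteq> 0 \<or> b \<noteq> 0" "a *\<^sub>R x + b *\<^sub>R y = 0"
    using assms(1) by (auto simp: linearly_dependent_pair_def)
  then have "a \<noteq> 0" using assms(3) by auto
  have "a *\<^sub>R x = - b *\<^sub>R y" using ab(2) by (simp add: eq_neg_iff_add_eq_0)
  then have "(1 / a) *\<^sub>R (a *\<^sub>R x) = (1 / a) *\<^sub>R (- b *\<^sub>R y)" by simp
  then have "x = (- b / a) *\<^sub>R y" using \<open>a \<noteq> 0\<close> by simp
  then show thesis by (rule that)
qed

section \<open>Frame relations of spatial curves and of curves in four-space\<close>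

lemma spatial_quaternionic_curveD:
  assumes "spatial_quaternionic_curve I \<alpha>" "s \<in> I"
  shows "tangent I \<alpha> s \<bullet> tangent I \<alpha> s = 1"
    and "principal_normal I \<alpha> s \<bullet> principal_normal I \<alpha> s = 1"
    and "principal_normal I \<alpha> s \<bullet> tangent I \<alpha> s = 0"
proof -
  have "orthonormal [tangent I \<alpha> s, principal_normal I \<alpha> s, binormal I \<alpha> s]"
    using assms by (auto simp: spatial_quaternionic_curve_def Let_def)
  then show "tangent I \<alpha> s \<bullet> tangent I \<alpha> s = 1"
    "principal_normal I \<alpha> s \<bullet> principal_normal I \<alpha> s = 1"
    "principal_normal I \<alpha> s \<bullet> tangent I \<alpha> s = 0"
    by (auto simp: orthonormal_def All_less_Suc inner_commute numeral_eq_Suc)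
qed

lemma associated_spatial_curveD:
  assumes "associated_spatial_curve I \<xi> \<alpha>" "s \<in> I"
  shows "spatial_quaternionic_curve I \<alpha>"
    and "curvature I \<xi> s > 0"
    and "principal_normal I \<xi> s = tangent I \<alpha> s \<times>\<^sub>Q tangent I \<xi> s"
    and "tangent I \<xi> s \<bullet> tangent I \<xi> s = 1"
    and "principal_normal I \<xi> s \<bullet> principal_normal I \<xi> s = 1"
    and "principal_normal I \<xi> s \<bullet> tangent I \<xi> s = 0"
    and "(\<xi> has_vector_derivative tangent I \<xi> s) (at s within I)"
    and "(tangent I \<xi> has_vector_derivative curvature I \<xi> s *\<^sub>R principal_normal I \<xi> s)
      (at s within I)"
    and "(principal_normal I \<xi> has_vector_derivative - curvature I \<xi> s *\<^sub>R tangent I \<xi> s +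
      curvature I \<alpha> s *\<^sub>R (principal_normal I \<alpha> s \<times>\<^sub>Q tangent I \<xi> s)) (at s within I)"
proof -
  show "spatial_quaternionic_curve I \<alpha>"
    and "curvature I \<xi> s > 0"
    and "principal_normal I \<xi> s = tangent I \<alpha> s \<times>\<^sub>Q tangent I \<xi> s"
    and "(\<xi> has_vector_derivative tangent I \<xi> s) (at s within I)"
    and "(tangent I \<xi> has_vector_derivative curvature I \<xi> s *\<^sub>R principal_normal I \<xi> s)
      (at s within I)"
    and "(principal_normal I \<xi> has_vector_derivative - curvature I \<xi> s *\<^sub>R tangent I \<xi> s +
      curvature I \<alpha> s *\<^sub>R (principal_normal I \<alpha> s \<times>\<^sub>Q tangent I \<xi> s)) (at s within I)"
    using assms unfolding associated_spatial_curve_def Let_def by blast+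
  have "orthonormal [tangent I \<xi> s, principal_normal I \<xi> s,
      principal_normal I \<alpha> s \<times>\<^sub>Q tangent I \<xi> s, binormal I \<alpha> s \<times>\<^sub>Q tangent I \<xi> s]"
    using assms unfolding associated_spatial_curve_def Let_def by blast
  then show "tangent I \<xi> s \<bullet> tangent I \<xi> s = 1"
    "principal_normal I \<xi> s \<bullet> principal_normal I \<xi> s = 1"
    "principal_normal I \<xi> s \<bullet> tangent I \<xi> s = 0"
    by (auto simp: orthonormal_def All_less_Suc inner_commute numeral_eq_Suc)
qed

section \<open>Differentiating relations that hold near a parameter\<close>

lemma has_vector_derivative_transform_nhds:
  assumes "(f has_vector_derivative f') (at s)" "\<forall>\<^sub>F x in nhds s. f x = g x"
  shows "(g has_vector_derivative f') (at s)"
  using assms unfolding eventually_nhds by (metis has_vector_derivative_transform_within_open)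

text \<open>Since \<open>f s - \<xi> s\<close> is parallel to \<open>T s\<close> and
  \<open>w\<close> is orthogonal to it, the product rule for the tangential coordinate leaves
  \<open>(v - T s) \<bullet> T s\<close>, which is -1. In the derivative of the point on the tangent
  line the two copies of \<open>T s\<close> then cancel.\<close>

lemma involute_derivative:
  fixes \<xi> T f :: "real \<Rightarrow> 'a::real_inner"
  assumes f: "(f has_vector_derivative v) (at s)"
    and \<xi>: "(\<xi> has_vector_derivative T s) (at s)"
    and T: "(T has_vector_derivative w) (at s)"
    and unit: "T s \<bullet> T s = 1" and perp: "v \<bullet> T s = 0" "w \<bullet> T s = 0"
    and ev: "\<forall>\<^sub>F x in nhds s. f x = \<xi> x + ((f x - \<xi> x) \<bullet> T x) *\<^sub>R T x"
  shows "((\<lambda>x. (f x - \<xi> x) \<bullet> T x) has_vector_derivative - 1) (at s)"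
    and "v = ((f s - \<xi> s) \<bullet> T s) *\<^sub>R w"
proof -
  define l where "l = (\<lambda>x. (f x - \<xi> x) \<bullet> T x)"
  have fs: "f s - \<xi> s = l s *\<^sub>R T s"
    using eventually_nhds_x_imp_x[OF ev] unfolding l_def by (metis add_diff_cancel_left')
  have "(f s - \<xi> s) \<bullet> w + (v - T s) \<bullet> T s = - 1"
    unfolding fs using unit perp by (simp add: inner_diff_left inner_commute[of _ w])
  then have l: "(l has_vector_derivative - 1) (at s)"
    using bounded_bilinear.has_vector_derivative[OF bounded_bilinear_inner
        has_vector_derivative_diff[OF f \<xi>] T]
    by (simp add: l_def)
  then show "((\<lambda>x. (f x - \<xi> x) \<bullet> T x) has_vector_derivative - 1) (at s)"
    by (simp add: l_def)
  have "((\<lambda>x. \<xi> x + l x *\<^sub>R T x) has_vector_derivative T s + (l s *\<^sub>R w + (- 1) *\<^sub>R T s)) (at s)"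
    by (intro has_vector_derivative_add \<xi>
        bounded_bilinear.has_vector_derivative[OF bounded_bilinear_scaleR l T])
  then have "((\<lambda>x. \<xi> x + l x *\<^sub>R T x) has_vector_derivative l s *\<^sub>R w) (at s)"
    by simp
  moreover have "\<forall>\<^sub>F x in nhds s. \<xi> x + l x *\<^sub>R T x = f x"
    using ev by (simp add: l_def eq_commute)
  ultimately have "(f has_vector_derivative l s *\<^sub>R w) (at s)"
    by (rule has_vector_derivative_transform_nhds)
  with f have "v = l s *\<^sub>R w"
    by (rule vector_derivative_unique_at)
  then show "v = ((f s - \<xi> s) \<bullet> T s) *\<^sub>R w"
    by (simp add: l_def)
qed

text \<open>The coefficient \<open>u x \<bullet> N x\<close> has square 1 near \<open>s\<close>;
  differentiating the square shows that its derivative vanishes, so only \<open>N'\<close> survives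
  in the product rule.\<close>

lemma unit_multiple_derivative:
  fixes u N :: "real \<Rightarrow> 'a::real_inner"
  assumes u: "(u has_vector_derivative u') (at s)"
    and N: "(N has_vector_derivative N') (at s)"
    and ev: "\<forall>\<^sub>F x in nhds s. u x = (u x \<bullet> N x) *\<^sub>R N x \<and> (u x \<bullet> N x)\<^sup>2 = 1"
  shows "u' = (u s \<bullet> N s) *\<^sub>R N'"
proof -
  define e where "e = (\<lambda>x. u x \<bullet> N x)"
  define e' where "e' = u s \<bullet> N' + u' \<bullet> N s"
  have e: "(e has_vector_derivative e') (at s)"
    unfolding e_def e'_def by (rule bounded_bilinear.has_vector_derivative[OF bounded_bilinear_inner u N])
  have "((\<lambda>x. e x * e x) has_vector_derivative e s * e' + e' * e s) (at s)"
    by (rule has_vector_derivative_mult[OF e e])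
  moreover have "\<forall>\<^sub>F x in nhds s. e x * e x = 1"
    using ev by eventually_elim (simp add: e_def power2_eq_square)
  ultimately have "((\<lambda>x. 1) has_vector_derivative e s * e' + e' * e s) (at s)"
    by (rule has_vector_derivative_transform_nhds)
  then have "e s * e' + e' * e s = 0"
    using vector_derivative_unique_at has_vector_derivative_const by blast
  moreover have "e s \<noteq> 0"
    using eventually_nhds_x_imp_x[OF ev] by (auto simp: e_def)
  ultimately have "e' = 0" by auto
  have "((\<lambda>x. e x *\<^sub>R N x) has_vector_derivative e s *\<^sub>R N' + e' *\<^sub>R N s) (at s)"
    by (rule bounded_bilinear.has_vector_derivative[OF bounded_bilinear_scaleR e N])
  then have "((\<lambda>x. e x *\<^sub>R N x) has_vector_derivative e s *\<^sub>R N') (at s)"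
    using \<open>e' = 0\<close> by simp
  moreover have "\<forall>\<^sub>F x in nhds s. e x *\<^sub>R N x = u x"
    using ev by eventually_elim (simp add: e_def)
  ultimately have "(u has_vector_derivative e s *\<^sub>R N') (at s)"
    by (rule has_vector_derivative_transform_nhds)
  with u show ?thesis
    unfolding e_def by (rule vector_derivative_unique_at)
qed

section \<open>Incompatibility of the two involute conditions\<close>

theorem theorem4p8:
  fixes I J :: "real set"
    and \<sigma> :: "real \<Rightarrow> real"
    and \<phi> \<xi> \<beta> \<alpha> :: "real \<Rightarrow> quat"
  assumes "is_interval I" and "interior I \<noteq> {}"
    and "is_interval J" and "interior J \<noteq> {}"
    and "bij_betw \<sigma> I J" and "\<sigma> differentiable_on I"
    and "associated_spatial_curve I \<xi> \<alpha>"
    and "associated_spatial_curve J \<phi> \<beta>"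
    and "quaternionic_involute_evolute J I \<sigma> \<phi> \<xi>"
  shows "\<not> spatial_involute_evolute J I \<sigma> \<beta> \<alpha>"
proof
  assume spat: "spatial_involute_evolute J I \<sigma> \<beta> \<alpha>"
  define T where "T = tangent I \<xi>"
  define N where "N = principal_normal I \<xi>"
  define \<kappa> where "\<kappa> = curvature I \<xi>"
  define u where "u = (\<lambda>s. tangent J \<phi> (\<sigma> s))"
  \<comment> \<open>As \<open>T\<close> is a unit vector, this is the coordinate along the tangent
    line. The multiplier in the involute condition is merely existential at each point; the explicit
    formula makes it differentiable.\<close>
  define l where "l = (\<lambda>s. (\<phi> (\<sigma> s) - \<xi> s) \<bullet> T s)"
  define d where "d = (\<lambda>s. vector_derivative \<sigma> (at s))"
  note \<xi>D = associated_spatial_curveD[OF \<open>associated_spatial_curve I \<xi> \<alpha>\<close>,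
      folded T_def N_def \<kappa>_def]
  note \<phi>D = associated_spatial_curveD[OF \<open>associated_spatial_curve J \<phi> \<beta>\<close>]
  have \<sigma>J: "\<sigma> s \<in> J" if "s \<in> I" for s
    using that \<open>bij_betw \<sigma> I J\<close> by (auto simp: bij_betw_def)
  \<comment> \<open>At interior parameters of \<open>I\<close> the derivatives are two-sided, so
    relations valid on a neighbourhood can be differentiated.\<close>
  have at: "at s within I = at s" if "s \<in> interior I" for s
    using that by (rule at_within_interior)
  have inI: "s \<in> I" if "s \<in> interior I" for s
    using that interior_subset by blast
  have near: "\<forall>\<^sub>F x in nhds s. x \<in> interior I" if "s \<in> interior I" for s
    using that by (intro eventually_nhds_in_open) auto
  have \<sigma>: "(\<sigma> has_vector_derivative d s) (at s)" if "s \<in> interior I" for s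
    using \<open>\<sigma> differentiable_on I\<close> that at[OF that] inI[OF that]
    unfolding differentiable_on_def d_def by (metis vector_derivative_works)
  \<comment> \<open>No interiority of \<open>\<sigma> s\<close> in \<open>J\<close> is claimed: the
    outer derivative stays within \<open>J\<close>, which is the image of \<open>I\<close>.\<close>
  have chain: "((\<lambda>x. g (\<sigma> x)) has_vector_derivative d s *\<^sub>R g') (at s)"
    if "(g has_vector_derivative g') (at (\<sigma> s) within J)" "s \<in> interior I"
    for g :: "real \<Rightarrow> quat" and g' s
  proof -
    have "\<sigma> ` I = J"
      using \<open>bij_betw \<sigma> I J\<close> by (simp add: bij_betw_def)
    then show ?thesis
      using vector_diff_chain_within[of \<sigma> "d s" s I g g'] that \<sigma> at
      by (simp add: o_def)
  qed
  have uT: "u s \<bullet> T s = 0" and on_line: "\<phi> (\<sigma> s) = \<xi> s + l s *\<^sub>R T s" if "s \<in> I" for s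
  proof -
    show "u s \<bullet> T s = 0"
      using \<open>quaternionic_involute_evolute J I \<sigma> \<phi> \<xi>\<close> that
      by (auto simp: quaternionic_involute_evolute_def quat_h_eq_0_iff u_def T_def)
    obtain m where "\<phi> (\<sigma> s) = \<xi> s + m *\<^sub>R T s"
      using \<open>quaternionic_involute_evolute J I \<sigma> \<phi> \<xi>\<close> \<open>s \<in> I\<close>
      unfolding quaternionic_involute_evolute_def T_def by blast
    then show "\<phi> (\<sigma> s) = \<xi> s + l s *\<^sub>R T s"
      using \<xi>D(4)[OF that] by (simp add: l_def)
  qed
  have l: "(l has_vector_derivative - 1) (at s)" and du: "d s *\<^sub>R u s = (l s * \<kappa> s) *\<^sub>R N s"
    if s: "s \<in> interior I" for s
  proof -
    have ev: "\<forall>\<^sub>F x in nhds s. \<phi> (\<sigma> x) = \<xi> x + ((\<phi> (\<sigma> x) - \<xi> x) \<bullet> T x) *\<^sub>R T x"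
      using near[OF s] by eventually_elim (use on_line inI in \<open>auto simp: l_def\<close>)
    note inv = involute_derivative[OF chain[OF \<phi>D(7)[OF \<sigma>J[OF inI[OF s]]] s, folded u_def]
        \<xi>D(7)[OF inI[OF s], unfolded at[OF s]] \<xi>D(8)[OF inI[OF s], unfolded at[OF s]]
        \<xi>D(4)[OF inI[OF s]] _ _ ev]
    show "(l has_vector_derivative - 1) (at s)"
      unfolding l_def using uT \<xi>D(6) inI[OF s] by (intro inv(1)) (simp_all add: u_def)
    have "d s *\<^sub>R u s = ((\<phi> (\<sigma> s) - \<xi> s) \<bullet> T s) *\<^sub>R \<kappa> s *\<^sub>R N s"
      unfolding u_def using uT \<xi>D(6) inI[OF s] by (intro inv(2)) (simp_all add: u_def)
    then show "d s *\<^sub>R u s = (l s * \<kappa> s) *\<^sub>R N s"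
      by (simp add: l_def)
  qed
  \<comment> \<open>If \<open>l\<close> vanished on the whole interior, its derivative there would
    be 0 instead of -1.\<close>
  obtain s where s: "s \<in> interior I" "l s \<noteq> 0"
  proof (rule ccontr)
    assume "\<not> thesis"
    with that have zero: "l s = 0" if "s \<in> interior I" for s
      using \<open>s \<in> interior I\<close> by blast
    obtain s where s: "s \<in> interior I"
      using \<open>interior I \<noteq> {}\<close> by blast
    have "((\<lambda>x. 0 :: real) has_vector_derivative - 1) (at s)"
      by (rule has_vector_derivative_transform_within_open[OF l[OF s] open_interior s zero])
    then have "(- 1 :: real) = 0"
      using vector_derivative_unique_at has_vector_derivative_const by blast
    then show False by simp
  qed
  note sI = inI[OF s(1)]
  have uu: "u x \<bullet> u x = 1" if "x \<in> I" for x
    using \<phi>D(4)[OF \<sigma>J[OF that]] by (simp add: u_def)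
  \<comment> \<open>The right-hand side of \<open>du\<close> is nonzero, so \<open>d x\<close> can
    be divided out; the resulting multiple of \<open>N x\<close> has coefficient of square 1 because
    both vectors are unit.\<close>
  have d0: "d x \<noteq> 0" and uN: "u x = (u x \<bullet> N x) *\<^sub>R N x \<and> (u x \<bullet> N x)\<^sup>2 = 1"
    if x: "x \<in> interior I" "l x \<noteq> 0" for x
  proof -
    have "l x * \<kappa> x \<noteq> 0" "N x \<noteq> 0"
      using x \<xi>D(2,5)[OF inI[OF x(1)]] by auto
    then show "d x \<noteq> 0"
      using du[OF x(1)] by auto
    then have "u x = (1 / d x) *\<^sub>R (d x *\<^sub>R u x)"
      by simp
    also have "\<dots> = (l x * \<kappa> x / d x) *\<^sub>R N x"
      unfolding du[OF x(1)] by simp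
    finally obtain m where m: "u x = m *\<^sub>R N x"
      by blast
    then have "u x \<bullet> N x = m" "m\<^sup>2 = 1"
      using uu[OF inI[OF x(1)]] \<xi>D(5)[OF inI[OF x(1)]] by (simp_all add: power2_eq_square)
    with m show "u x = (u x \<bullet> N x) *\<^sub>R N x \<and> (u x \<bullet> N x)\<^sup>2 = 1"
      by metis
  qed
  \<comment> \<open>Continuity spreads \<open>l s \<noteq> 0\<close> to a neighbourhood, as needed
    for differentiating \<open>uN\<close>.\<close>
  have "isCont l s"
    using l[OF s(1)] by (rule has_vector_derivative_continuous)
  then have "\<forall>\<^sub>F x in nhds s. l x \<noteq> 0"
    using s(2) unfolding isCont_def tendsto_at_iff_tendsto_nhds
    by (rule tendsto_imp_eventually_ne)
  with near[OF s(1)]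
  have ev: "\<forall>\<^sub>F x in nhds s. u x = (u x \<bullet> N x) *\<^sub>R N x \<and> (u x \<bullet> N x)\<^sup>2 = 1"
    by eventually_elim (rule uN)
  define e where "e = u s \<bullet> N s"
  define M where "M = principal_normal J \<phi> (\<sigma> s)"
  define B where "B = principal_normal I \<alpha> s \<times>\<^sub>Q T s"
  note t\<beta> = spatial_quaternionic_curveD[OF \<phi>D(1)[OF \<sigma>J[OF sI]] \<sigma>J[OF sI]]
  note t\<alpha> = spatial_quaternionic_curveD[OF \<xi>D(1)[OF sI] sI]
  \<comment> \<open>Both sides express the derivative of \<open>u\<close> at \<open>s\<close>: by
    the Frenet equation of \<phi> and the chain rule, and by that of \<xi> applied to
    \<open>N\<close>.\<close>
  have M: "d s *\<^sub>R curvature J \<phi> (\<sigma> s) *\<^sub>R M = e *\<^sub>R (- \<kappa> s *\<^sub>R T s + curvature I \<alpha> s *\<^sub>R B)"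
    unfolding e_def M_def B_def
    by (rule unit_multiple_derivative[OF
          chain[OF \<phi>D(8)[OF \<sigma>J[OF sI]] s(1), folded u_def]
          \<xi>D(9)[OF sI, unfolded at[OF s(1)]] ev])
  obtain c where c: "tangent J \<beta> (\<sigma> s) = c *\<^sub>R principal_normal I \<alpha> s"
    using spat sI t\<beta>(1) t\<alpha>(2)
    by (elim linearly_dependent_pair_scaleR[rotated -1])
      (auto simp: spatial_involute_evolute_def)
  \<comment> \<open>The spatial condition enters through \<open>c\<close>. The product on the right
    is minus the fourth frame vector of \<xi>, since \<open>n\<close> times \<open>t\<close> is
    minus the binormal.\<close>
  have Meq: "M = (c * e) *\<^sub>R (principal_normal I \<alpha> s \<times>\<^sub>Q (tangent I \<alpha> s \<times>\<^sub>Q T s))"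
  proof -
    have "M = tangent J \<beta> (\<sigma> s) \<times>\<^sub>Q u s"
      unfolding M_def u_def by (rule \<phi>D(3)[OF \<sigma>J[OF sI]])
    also have "u s = e *\<^sub>R N s"
      using uN[OF s] by (simp add: e_def)
    finally show ?thesis
      using c \<xi>D(3)[OF sI] by simp
  qed
  \<comment> \<open>The scalar part of \<open>t\<close> is read off from the orthogonality of
    \<open>N s\<close>, which is \<open>t\<close> times \<open>T s\<close>, to the unit vector
    \<open>T s\<close>.\<close>
  have t1: "tangent I \<alpha> s $ 1 = 0"
    using \<xi>D(6)[OF sI] \<xi>D(4)[OF sI] unfolding \<xi>D(3)[OF sI]
    by (simp add: inner_quat_mult_same)
  have "M \<bullet> T s = 0"
    unfolding Meq using t1 t\<alpha>(3) by (simp add: inner_quat_mult_mult_same)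
  moreover have "M \<bullet> B = 0"
    unfolding Meq B_def using t1
    by (simp add: inner_quat_mult_left inner_quat_mult_same)
  moreover have "M \<bullet> M = 1"
    using \<phi>D(5)[OF \<sigma>J[OF sI]] by (simp add: M_def)
  \<comment> \<open>Pairing equation \<open>M\<close> with the unit vector \<open>M\<close> kills
    its right-hand side.\<close>
  ultimately have "d s * curvature J \<phi> (\<sigma> s) = 0"
    using arg_cong[OF M, of "\<lambda>v. M \<bullet> v"] by (simp add: inner_add_right inner_diff_right)
  then show False
    using d0[OF s] \<phi>D(2)[OF \<sigma>J[OF sI]] by simp
qed

end
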